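(* For a positive integer $n$, the power graph $P(S_n)$ of the symmetric group $S_n$ is a firefly-type graph if and only if $n=3$.
   Context: The power graph $P(G)$ of a finite group $G$ is the simple graph with vertex set $G$ in which two distinct vertices $u,v$ are adjacent if and only if $u\in\langle v\rangle$ or $v\in\langle u\rangle$. For integers $1\le p\le m-1$, the firefly-type graph $F_{p,m-p}$ is $K_1\vee\left(pK_1\cup(m-p)K_2\right)$: a single vertex joined to all vertices of the disjoint union of $p$ copies of $K_1$ and $m-p$ copies of $K_2$. A graph is a firefly-type graph if it is isomorphic to $F_{p,m-p}$ for some integers $1\le p\le m-1$. *)

theory Defs
  imports
    "HOL-Algebra.Sym_Groups"
    "Graph_Theory.Pair_Digraph"
    "Graph_Theory.Digraph_Isomorphism"
begin

text \<open>
  A finite simple graph is a \<open>pair_graph\<close>, i.e. a finite loop-free digraph with a symmetric set of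
  arcs: each undirected edge between \<open>u\<close> and \<open>v\<close> is recorded as the two arcs \<open>(u, v)\<close> and \<open>(v, u)\<close>.
\<close>

definition power_graph :: "('a, 'b) monoid_scheme \<Rightarrow> 'a pair_pre_digraph" where
  "power_graph G =
    \<lparr> pverts = carrier G,
      parcs = {(u, v). u \<in> carrier G \<and> v \<in> carrier G \<and> u \<noteq> v \<and>
                (u \<in> generate G {v} \<or> v \<in> generate G {u})} \<rparr>"

definition complete_graph :: "nat \<Rightarrow> nat pair_pre_digraph" where
  "complete_graph n =
    \<lparr> pverts = {..<n}, parcs = {(u, v). u < n \<and> v < n \<and> u \<noteq> v} \<rparr>"

definition graph_copies :: "nat \<Rightarrow> 'a pair_pre_digraph \<Rightarrow> (nat \<times> 'a) pair_pre_digraph" where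
  "graph_copies k G =
    \<lparr> pverts = {..<k} \<times> pverts G,
      parcs = {((i, u), (i, v)) | i u v. i < k \<and> (u, v) \<in> parcs G} \<rparr>"

definition graph_union ::
    "'a pair_pre_digraph \<Rightarrow> 'b pair_pre_digraph \<Rightarrow> ('a + 'b) pair_pre_digraph" where
  "graph_union G H =
    \<lparr> pverts = pverts G <+> pverts H,
      parcs = {(Inl u, Inl v) | u v. (u, v) \<in> parcs G} \<union>
              {(Inr u, Inr v) | u v. (u, v) \<in> parcs H} \<rparr>"

definition graph_join ::
    "'a pair_pre_digraph \<Rightarrow> 'b pair_pre_digraph \<Rightarrow> ('a + 'b) pair_pre_digraph" where
  "graph_join G H =
    \<lparr> pverts = pverts G <+> pverts H,
      parcs = parcs (graph_union G H) \<union>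
              {(Inl u, Inr v) | u v. u \<in> pverts G \<and> v \<in> pverts H} \<union>
              {(Inr v, Inl u) | u v. u \<in> pverts G \<and> v \<in> pverts H} \<rparr>"

text \<open>\<open>firefly p q\<close> is $F_{p,q} = K_1 \vee (p K_1 \cup q K_2)$.\<close>

definition firefly ::
    "nat \<Rightarrow> nat \<Rightarrow> (nat + ((nat \<times> nat) + (nat \<times> nat))) pair_pre_digraph" where
  "firefly p q =
    graph_join (complete_graph 1)
      (graph_union (graph_copies p (complete_graph 1)) (graph_copies q (complete_graph 2)))"

text \<open>
  Truncated subtraction is harmless below: \<open>1 \<le> p \<and> p \<le> m - 1\<close> forces \<open>m \<ge> 2\<close>.
\<close>

definition firefly_type :: "'a pair_pre_digraph \<Rightarrow> bool" where
  "firefly_type G \<longleftrightarrow>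
    (\<exists>p m. 1 \<le> p \<and> p \<le> m - 1 \<and> digraph_iso (with_proj G) (with_proj (firefly p (m - p))))"

lemma (in group) pair_graph_power_graph:
  assumes "finite (carrier G)"
  shows "pair_graph (power_graph G)"
proof
  show "finite (parcs (power_graph G))"
    by (rule finite_subset[of _ "carrier G \<times> carrier G"]) (auto simp: power_graph_def assms)
qed (auto simp: power_graph_def assms symmetric_def sym_def)

lemma pair_graph_complete_graph: "pair_graph (complete_graph n)"
proof
  show "finite (parcs (complete_graph n))"
    by (rule finite_subset[of _ "{..<n} \<times> {..<n}"]) (auto simp: complete_graph_def)
qed (auto simp: complete_graph_def symmetric_def sym_def)

lemma pair_graph_graph_copies:
  assumes "pair_graph G"
  shows "pair_graph (graph_copies k G)"
proof -
  interpret pair_graph G by fact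
  have s: "(v, u) \<in> parcs G" if "(u, v) \<in> parcs G" for u v
    using that pair_sym_arcs by (auto simp: symmetric_def dest: symD)
  show ?thesis
  proof
    show "finite (parcs (graph_copies k G))"
      by (rule finite_subset[of _ "({..<k} \<times> pverts G) \<times> ({..<k} \<times> pverts G)"])
         (auto simp: graph_copies_def pair_finite_verts dest: wellformed')
  qed (auto simp: graph_copies_def symmetric_def sym_def pair_finite_verts
        dest: wellformed' pair_no_loops s)
qed

lemma pair_graph_graph_join:
  assumes "pair_graph G" "pair_graph H"
  shows "pair_graph (graph_join G H)" "pair_graph (graph_union G H)"
proof -
  interpret G: pair_graph G by fact
  interpret H: pair_graph H by fact
  have s: "(u, v) \<in> parcs G \<Longrightarrow> (v, u) \<in> parcs G" "(x, y) \<in> parcs H \<Longrightarrow> (y, x) \<in> parcs H"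
    for u v x y
    using G.pair_sym_arcs H.pair_sym_arcs by (auto simp: symmetric_def dest: symD)
  let ?V = "pverts G <+> pverts H"
  show "pair_graph (graph_join G H)"
  proof
    show "finite (parcs (graph_join G H))"
      by (rule finite_subset[of _ "?V \<times> ?V"])
         (auto simp: graph_join_def graph_union_def G.pair_finite_verts H.pair_finite_verts
            dest: G.wellformed' H.wellformed')
  qed (auto simp: graph_join_def graph_union_def symmetric_def sym_def
        G.pair_finite_verts H.pair_finite_verts
        dest: G.wellformed' H.wellformed' G.pair_no_loops H.pair_no_loops s)
  show "pair_graph (graph_union G H)"
  proof
    show "finite (parcs (graph_union G H))"
      by (rule finite_subset[of _ "?V \<times> ?V"])
         (auto simp: graph_union_def G.pair_finite_verts H.pair_finite_verts
            dest: G.wellformed' H.wellformed')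
  qed (auto simp: graph_union_def symmetric_def sym_def
        G.pair_finite_verts H.pair_finite_verts
        dest: G.wellformed' H.wellformed' G.pair_no_loops H.pair_no_loops s)
qed

lemma pair_graph_firefly: "pair_graph (firefly p q)"
  unfolding firefly_def
  by (intro pair_graph_graph_join pair_graph_graph_copies pair_graph_complete_graph)

end

theory Submission
  imports Defs
begin

text \<open>
  The cliques of a firefly graph lie inside a single triangle or edge through its centre, so they
  have at most three vertices. In a power graph, on the other hand, a cyclic subgroup of order four
  is a clique: its two generators generate each other, and the identity and the involution lie in
  the subgroup that each of them generates. Hence a power graph of firefly type comes from a group
  without elements of order four, and for \<open>n \<ge> 4\<close> the four-cycle \<open>(1 2 3 4)\<close> rules out \<open>S\<^sub>n\<close>.
  For \<open>n \<le> 2\<close> the group has at most two elements, while a firefly graph with at least one pendant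
  vertex and at least one triangle has at least four vertices.

  For \<open>n = 3\<close> every nontrivial cyclic subgroup has prime order, so any two of them meet only in the
  identity, and the power graph consists of complete graphs glued together at the identity. There
  are three subgroups of order two and one of order three, which gives three pendant edges and one
  triangle.
\<close>

section \<open>Isomorphisms of simple graphs\<close>

text \<open>
  A digraph isomorphism may relabel vertices and arcs independently. When arcs are pairs of
  vertices, the relabelling of the arcs is determined by that of the vertices, and only an
  adjacency preserving bijection remains.
\<close>

lemma digraph_iso_with_proj_iff:
  assumes "pair_wf_digraph G" "pair_wf_digraph H"
  shows "digraph_iso (with_proj G) (with_proj H) \<longleftrightarrow>
    (\<exists>f. bij_betw f (pverts G) (pverts H) \<and>
      (\<forall>u\<in>pverts G. \<forall>v\<in>pverts G. (u, v) \<in> parcs G \<longleftrightarrow> (f u, f v) \<in> parcs H))"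
    (is "?L \<longleftrightarrow> ?R")
proof
  interpret G: pair_wf_digraph G by fact
  assume ?L
  then obtain h where h: "pre_digraph.digraph_isomorphism (with_proj G) h"
    and H: "with_proj H = app_iso h (with_proj G)"
    by (auto simp: digraph_iso_def)
  let ?f = "iso_verts h"
  have inj: "inj_on ?f (pverts G)"
    using h by (simp add: pre_digraph.digraph_isomorphism_def)
  have verts: "pverts H = ?f ` pverts G"
    using arg_cong[OF H, of verts] by simp
  have "iso_tail h = fst" "iso_head h = snd"
    using arg_cong[OF H, of tail] arg_cong[OF H, of head] by simp_all
  then have "iso_arcs h a = map_prod ?f ?f a" if "a \<in> parcs G" for a
    using h that by (simp add: pre_digraph.digraph_isomorphism_def prod_eq_iff)
  then have arcs: "parcs H = map_prod ?f ?f ` parcs G"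
    using arg_cong[OF H, of arcs] by simp
  have "(u, v) \<in> parcs G \<longleftrightarrow> (?f u, ?f v) \<in> parcs H" if "u \<in> pverts G" "v \<in> pverts G" for u v
  proof
    assume "(?f u, ?f v) \<in> parcs H"
    then obtain a b where "(a, b) \<in> parcs G" "?f u = ?f a" "?f v = ?f b"
      unfolding arcs by auto
    moreover from this have "a \<in> pverts G" "b \<in> pverts G"
      using G.wellformed' by auto
    ultimately show "(u, v) \<in> parcs G"
      using that inj by (simp add: inj_on_eq_iff)
  qed (auto simp: arcs intro: rev_image_eqI)
  with inj verts show ?R by (auto simp: bij_betw_def)
next
  interpret G: pair_wf_digraph G by fact
  interpret H: pair_wf_digraph H by fact
  assume ?R
  then obtain f where inj: "inj_on f (pverts G)" and verts: "f ` pverts G = pverts H"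
    and adj: "\<And>u v. u \<in> pverts G \<Longrightarrow> v \<in> pverts G \<Longrightarrow> (u, v) \<in> parcs G \<longleftrightarrow> (f u, f v) \<in> parcs H"
    by (auto simp: bij_betw_def)
  let ?h = "\<lparr> iso_verts = f, iso_arcs = map_prod f f, iso_head = snd, iso_tail = fst \<rparr>"
  have sub: "parcs G \<subseteq> pverts G \<times> pverts G"
    using G.wellformed' by auto
  have "map_prod f f ` parcs G = parcs H"
  proof (intro equalityI subsetI)
    fix e assume "e \<in> map_prod f f ` parcs G"
    then show "e \<in> parcs H" using sub adj by auto
  next
    fix e assume e: "e \<in> parcs H"
    then obtain u v where "e = (f u, f v)" "u \<in> pverts G" "v \<in> pverts G"
      using H.wellformed'[of "fst e" "snd e"] unfolding verts[symmetric]
      by (cases e) auto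
    then show "e \<in> map_prod f f ` parcs G" using e adj by (auto intro!: rev_image_eqI)
  qed
  then have "with_proj H = app_iso ?h (with_proj G)"
    using verts by (simp add: app_iso_def with_proj_def)
  moreover have "inj_on (map_prod f f) (parcs G)"
    using map_prod_inj_on[OF inj inj] sub by (rule inj_on_subset)
  then have "pre_digraph.digraph_isomorphism (with_proj G) ?h"
    using inj G.wf_digraph_axioms by (simp add: pre_digraph.digraph_isomorphism_def)
  ultimately show ?L by (auto simp: digraph_iso_def)
qed

section \<open>Firefly graphs\<close>

lemma pverts_firefly:
  "pverts (firefly p q) = {..<1} <+> (({..<p} \<times> {..<1}) <+> ({..<q} \<times> {..<2}))"
  by (simp add: firefly_def graph_join_def graph_union_def graph_copies_def complete_graph_def)

lemma card_pverts_firefly: "card (pverts (firefly p q)) = 1 + p + 2 * q"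
  unfolding pverts_firefly
  by (subst card_Plus, simp, simp, subst card_Plus) (simp_all add: card_cartesian_product)

lemma parcs_firefly:
  "parcs (firefly p q) =
    {(Inl 0, Inr v) | v. Inr v \<in> pverts (firefly p q)} \<union>
    {(Inr v, Inl 0) | v. Inr v \<in> pverts (firefly p q)} \<union>
    {(Inr (Inr (i, j)), Inr (Inr (i, k))) | i j k. i < q \<and> j < 2 \<and> k < 2 \<and> j \<noteq> k}"
  by (auto simp: firefly_def graph_join_def graph_union_def graph_copies_def complete_graph_def)

lemma card_clique_firefly_le_3:
  assumes K: "K \<subseteq> pverts (firefly p q)"
    and clique: "\<And>u v. u \<in> K \<Longrightarrow> v \<in> K \<Longrightarrow> u \<noteq> v \<Longrightarrow> (u, v) \<in> parcs (firefly p q)"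
  shows "card K \<le> 3"
proof -
  consider (triangle) i j where "Inr (Inr (i, j)) \<in> K"
    | (pendant) x where "Inr (Inl x) \<in> K"
    | (centre) "K \<subseteq> {Inl 0}"
    using K unfolding pverts_firefly by fastforce
  then obtain a b where sub: "K \<subseteq> {Inl 0, a, b}"
  proof cases
    case triangle
    have "K \<subseteq> {Inl 0, Inr (Inr (i, 0)), Inr (Inr (i, 1))}"
    proof
      fix v assume "v \<in> K"
      then have "v \<in> pverts (firefly p q)"
        and "v = Inr (Inr (i, j)) \<or> (Inr (Inr (i, j)), v) \<in> parcs (firefly p q)"
        using K clique[OF triangle] by auto
      then show "v \<in> {Inl 0, Inr (Inr (i, 0)), Inr (Inr (i, 1))}"
        unfolding pverts_firefly parcs_firefly by (auto simp: less_2_cases_iff)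
    qed
    then show ?thesis by (rule that)
  next
    case pendant
    \<comment> \<open>A pendant vertex has the centre as its only neighbour; it fills both remaining slots.\<close>
    have "K \<subseteq> {Inl 0, Inr (Inl x), Inr (Inl x)}"
    proof
      fix v assume "v \<in> K"
      then show "v \<in> {Inl 0, Inr (Inl x), Inr (Inl x)}"
        using clique[OF pendant, of v] unfolding parcs_firefly by auto
    qed
    then show ?thesis by (rule that)
  next
    case centre
    then show ?thesis using that by blast
  qed
  have "card K \<le> card {Inl 0, a, b}"
    using sub by (intro card_mono) auto
  also have "\<dots> \<le> 3" by (simp add: card_insert_if)
  finally show ?thesis .
qed

section \<open>Cyclic subgroups in power graphs\<close>

lemma pverts_power_graph: "pverts (power_graph G) = carrier G"
  by (simp add: power_graph_def)

lemma parcs_power_graph: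
  "(u, v) \<in> parcs (power_graph G) \<longleftrightarrow>
    u \<in> carrier G \<and> v \<in> carrier G \<and> u \<noteq> v \<and> (u \<in> generate G {v} \<or> v \<in> generate G {u})"
  by (simp add: power_graph_def)

context group
begin

lemma generate_involution:
  assumes a: "a \<in> carrier G" and sq: "a \<otimes> a = \<one>"
  shows "generate G {a} = {\<one>, a}"
proof (rule generateI[symmetric])
  have "inv a = a" using inv_equality[OF sq] a by simp
  then show "subgroup {\<one>, a} G"
    using a sq by (auto intro!: subgroupI)
qed (simp_all add: subgroup.one_closed)

lemma generate_cube_one:
  assumes a: "a \<in> carrier G" and cube: "a \<otimes> (a \<otimes> a) = \<one>"
  shows "generate G {a} = {\<one>, a, a \<otimes> a}"
proof (rule generateI[symmetric])
  have cube': "a \<otimes> a \<otimes> a = \<one>" using a cube by (simp add: m_assoc)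
  have "inv a = a \<otimes> a" "inv (a \<otimes> a) = a"
    using inv_equality[OF cube'] inv_equality[OF cube] a by simp_all
  moreover have "a \<otimes> a \<otimes> (a \<otimes> a) = a"
    using a cube by (simp add: m_assoc)
  ultimately show "subgroup {\<one>, a, a \<otimes> a} G"
    using a cube cube' by (auto intro!: subgroupI)
qed (simp_all add: subgroup.one_closed subgroup.m_closed)

text \<open>
  Every power of \<open>x\<close> is adjacent to \<open>x\<close>, and the identity is adjacent to everything. The one
  remaining pair is \<open>x\<^sup>2\<close> and \<open>x\<^sup>3\<close>, where \<open>x\<^sup>2 = x\<^sup>6\<close> is the square of \<open>x\<^sup>3\<close>.
\<close>

lemma power_graph_clique_of_order_four:
  assumes x: "x \<in> carrier G" and four: "x [^] (4::nat) = \<one>"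
    and uv: "u \<in> {\<one>, x, x [^] (2::nat), x [^] (3::nat)}"
      "v \<in> {\<one>, x, x [^] (2::nat), x [^] (3::nat)}" "u \<noteq> v"
  shows "(u, v) \<in> parcs (power_graph G)"
proof -
  have one: "\<one> \<in> generate G {y}" for y
    by (rule generate.one)
  have pow: "y [^] k \<in> generate G {y}" if "y \<in> carrier G" for y and k :: nat
    using that generate_pow[OF that] by (auto simp flip: int_pow_int)
  have "(x [^] (3::nat)) [^] (2::nat) = x [^] (4 + 2 :: nat)"
    using x by (simp add: nat_pow_pow)
  also have "\<dots> = x [^] (2::nat)"
    using x four by (subst nat_pow_mult[symmetric]) simp_all
  finally have "x [^] (2::nat) \<in> generate G {x [^] (3::nat)}"
    using pow[of "x [^] (3::nat)" 2] x by simp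
  then show ?thesis
    using uv x one pow[OF x, of 2] pow[OF x, of 3] by (auto simp: parcs_power_graph)
qed

end

section \<open>Power graphs of symmetric groups\<close>

lemma pair_wf_digraph_power_graph_sym_group: "pair_wf_digraph (power_graph (sym_group n))"
proof -
  have "finite (carrier (sym_group n))"
    by (simp add: sym_group_def finite_permutations)
  then interpret pair_graph "power_graph (sym_group n)"
    by (rule group.pair_graph_power_graph[OF sym_group_is_group])
  show ?thesis ..
qed

lemma pair_wf_digraph_firefly: "pair_wf_digraph (firefly p q)"
proof -
  interpret pair_graph "firefly p q" by (rule pair_graph_firefly)
  show ?thesis ..
qed

lemma power_graph_sym_group_not_firefly_type:
  assumes "n \<ge> 4"
  shows "\<not> firefly_type (power_graph (sym_group n))"
proof
  interpret S: group "sym_group n" by (rule sym_group_is_group)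
  assume "firefly_type (power_graph (sym_group n))"
  then obtain p q f
    where f: "bij_betw f (carrier (sym_group n)) (pverts (firefly p q))"
      and adj: "\<And>u v. u \<in> carrier (sym_group n) \<Longrightarrow> v \<in> carrier (sym_group n) \<Longrightarrow>
        (u, v) \<in> parcs (power_graph (sym_group n)) \<Longrightarrow> (f u, f v) \<in> parcs (firefly p q)"
    unfolding firefly_type_def
      digraph_iso_with_proj_iff[OF pair_wf_digraph_power_graph_sym_group pair_wf_digraph_firefly]
      pverts_power_graph by blast
  define c :: "nat \<Rightarrow> nat" where "c = transpose 1 2 \<circ> transpose 2 3 \<circ> transpose 3 4"
  define K where "K = {id, c, c \<circ> c, c \<circ> (c \<circ> c)}"
  have c: "c \<in> carrier (sym_group n)"
    using assms by (auto simp: c_def sym_group_carrier intro!: permutes_compose permutes_swap_id)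
  have c4: "c \<circ> (c \<circ> (c \<circ> c)) = id"
  proof
    fix x :: nat
    consider "x = 1" | "x = 2" | "x = 3" | "x = 4" | "x \<notin> {1, 2, 3, 4}" by auto
    then show "(c \<circ> (c \<circ> (c \<circ> c))) x = id x"
      by cases (simp_all add: c_def transpose_def)
  qed
  have pow: "c [^]\<^bsub>sym_group n\<^esub> (2::nat) = c \<circ> c"
    "c [^]\<^bsub>sym_group n\<^esub> (3::nat) = c \<circ> (c \<circ> c)"
    "c [^]\<^bsub>sym_group n\<^esub> (4::nat) = id"
    using c4 by (simp_all add: numeral_eq_Suc sym_group_mult sym_group_one comp_assoc)
  have K: "K \<subseteq> carrier (sym_group n)"
    using c by (auto simp: K_def sym_group_carrier intro!: permutes_compose permutes_id)
  have clique: "(u, v) \<in> parcs (power_graph (sym_group n))" if "u \<in> K" "v \<in> K" "u \<noteq> v" for u v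
    using S.power_graph_clique_of_order_four[OF c, of u v] that
    by (simp add: K_def pow sym_group_one)
  \<comment> \<open>The four powers of \<open>c\<close> send \<open>1\<close> to different points.\<close>
  have "(\<lambda>g. g 1) ` K = {1, 2, 3, 4 :: nat}"
    by (simp add: K_def c_def transpose_def)
  then have "4 \<le> card K"
    using card_image_le[of K "\<lambda>g. g 1"] by (simp add: K_def)
  moreover have "inj_on f K"
    using f K by (auto simp: bij_betw_def intro: inj_on_subset)
  ultimately have "4 \<le> card (f ` K)"
    by (simp add: card_image)
  moreover have "card (f ` K) \<le> 3"
  proof (rule card_clique_firefly_le_3)
    show "f ` K \<subseteq> pverts (firefly p q)"
      using f K by (auto simp: bij_betw_def)
    show "(u, v) \<in> parcs (firefly p q)" if "u \<in> f ` K" "v \<in> f ` K" "u \<noteq> v" for u v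
      using that adj clique K by blast
  qed
  ultimately show False by simp
qed

lemma firefly_type_power_graph_sym_group_imp_fact_ge_4:
  assumes "firefly_type (power_graph (sym_group n))"
  shows "4 \<le> (fact n :: nat)"
proof -
  from assms obtain p m f where pm: "1 \<le> p" "p \<le> m - 1"
    and f: "bij_betw f (carrier (sym_group n)) (pverts (firefly p (m - p)))"
    unfolding firefly_type_def
      digraph_iso_with_proj_iff[OF pair_wf_digraph_power_graph_sym_group pair_wf_digraph_firefly]
      pverts_power_graph by blast
  have "fact n = 1 + p + 2 * (m - p)"
    using bij_betw_same_card[OF f] card_permutations[of "{1..n}" n]
    by (simp add: card_pverts_firefly sym_group_def)
  with pm show ?thesis by linarith
qed

text \<open>
  The three transpositions become the pendant vertices, and the three-cycle \<open>c\<close> and its inverse \<open>d\<close>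
  become the copy of \<open>K\<^sub>2\<close>. All adjacencies can be read off from the six cyclic subgroups.
\<close>

lemma firefly_type_power_graph_sym_group_3: "firefly_type (power_graph (sym_group 3))"
proof -
  let ?S = "sym_group 3"
  interpret S: group ?S by (rule sym_group_is_group)
  interpret F: pair_wf_digraph "firefly 3 1" by (rule pair_wf_digraph_firefly)
  define r s t c d :: "nat \<Rightarrow> nat"
    where "r = transpose 1 2" and "s = transpose 1 3" and "t = transpose 2 3"
      and "c = r \<circ> t" and "d = t \<circ> r"
  note defs = r_def s_def t_def c_def d_def
  have carrier: "id \<in> carrier ?S" "r \<in> carrier ?S" "s \<in> carrier ?S" "t \<in> carrier ?S"
    "c \<in> carrier ?S" "d \<in> carrier ?S"
    by (auto simp: defs sym_group_carrier intro!: permutes_compose permutes_swap_id permutes_id)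
  have products: "r \<circ> r = id" "s \<circ> s = id" "t \<circ> t = id"
    "c \<circ> c = d" "d \<circ> d = c" "c \<circ> d = id" "d \<circ> c = id"
    by (auto simp: fun_eq_iff defs transpose_def)
  \<comment> \<open>A permutation of \<open>{1, 2, 3}\<close> is determined by its values at \<open>1\<close> and \<open>2\<close>.\<close>
  have "distinct (map (\<lambda>g. (g 1, g 2)) [id, r, s, t, c, d])"
    by (simp add: defs transpose_def)
  then have distinct: "distinct [id, r, s, t, c, d]"
    by (simp only: distinct_map)
  have elements: "carrier ?S = {id, r, s, t, c, d}"
  proof (rule card_subset_eq[symmetric])
    show "finite (carrier ?S)"
      by (simp add: sym_group_def finite_permutations)
    show "{id, r, s, t, c, d} \<subseteq> carrier ?S" using carrier by simp
    have "card (carrier ?S) = 6"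
      using card_permutations[of "{1..3::nat}" 3] by (simp add: sym_group_def fact_numeral)
    then show "card {id, r, s, t, c, d} = card (carrier ?S)"
      using distinct_card[OF distinct] by simp
  qed
  have gens: "generate ?S {id} = {id}"
    "generate ?S {r} = {id, r}" "generate ?S {s} = {id, s}" "generate ?S {t} = {id, t}"
    "generate ?S {c} = {id, c, d}" "generate ?S {d} = {id, d, c}"
    using S.generate_one S.generate_involution[of r] S.generate_involution[of s]
      S.generate_involution[of t] S.generate_cube_one[of c] S.generate_cube_one[of d]
    by (simp_all add: carrier products sym_group_mult sym_group_one)
  define f where "f v = (case v of Inl _ \<Rightarrow> id
      | Inr (Inl (i, _)) \<Rightarrow> [r, s, t] ! i
      | Inr (Inr (_, j)) \<Rightarrow> [c, d] ! j)"
    for v :: "nat + ((nat \<times> nat) + (nat \<times> nat))"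
  have verts: "pverts (firefly 3 1) = {Inl 0, Inr (Inl (0, 0)), Inr (Inl (1, 0)), Inr (Inl (2, 0)),
      Inr (Inr (0, 0)), Inr (Inr (0, 1))}"
    unfolding pverts_firefly by (auto simp: numeral_eq_Suc less_Suc_eq)
  have "bij_betw f (pverts (firefly 3 1)) (pverts (power_graph ?S))"
    using distinct unfolding verts pverts_power_graph elements
    by (auto simp: bij_betw_def f_def)
  moreover have "\<forall>u\<in>pverts (firefly 3 1). \<forall>v\<in>pverts (firefly 3 1).
      (u, v) \<in> parcs (firefly 3 1) \<longleftrightarrow> (f u, f v) \<in> parcs (power_graph ?S)"
    using distinct unfolding parcs_firefly verts parcs_power_graph elements
    by (simp add: f_def gens) (elim conjE, simp)
  ultimately have "digraph_iso (with_proj (firefly 3 1)) (with_proj (power_graph ?S))"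
    unfolding digraph_iso_with_proj_iff[OF pair_wf_digraph_firefly
        pair_wf_digraph_power_graph_sym_group] by blast
  moreover have "wf_digraph (with_proj (firefly 3 1))"
    using F.wf_digraph_axioms by simp
  ultimately have "digraph_iso (with_proj (power_graph ?S)) (with_proj (firefly 3 (4 - 3)))"
    by (simp add: digraph_iso_swap)
  then show ?thesis
    unfolding firefly_type_def by (intro exI[of _ 3] exI[of _ 4]) simp
qed

theorem corollary3p2:
  fixes n :: nat
  assumes "n \<ge> 1"
  shows "firefly_type (power_graph (sym_group n)) \<longleftrightarrow> n = 3"
proof
  assume firefly: "firefly_type (power_graph (sym_group n))"
  then have "n < 4"
    using power_graph_sym_group_not_firefly_type[of n] by linarith
  moreover have "n \<noteq> 1" "n \<noteq> 2"
    using firefly_type_power_graph_sym_group_imp_fact_ge_4[OF firefly] by auto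
  ultimately show "n = 3" using assms by linarith
qed (simp add: firefly_type_power_graph_sym_group_3)

end
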